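(* Let $\alpha_1,\alpha_2,\alpha_3\in\mathbb{C}$ satisfy $2\alpha_1+2\alpha_2+\alpha_3=0$, and let $K_1,K_2\in\mathbb{C}[q_1,p_1,q_2,p_2]$ be the polynomials given in the context. The system in two variables $t,s$ $$dq_i=\frac{\partial K_1}{\partial p_i}dt+\frac{\partial K_2}{\partial p_i}ds,\qquad dp_i=-\frac{\partial K_1}{\partial q_i}dt-\frac{\partial K_2}{\partial q_i}ds\qquad(i=1,2)$$ is invariant under the following birational and symplectic transformations, where $( * ):=(q_1,p_1,q_2,p_2,t,s;\alpha_1,\alpha_2,\alpha_3)$ and $f:=p_1-q_1^2-p_2$, $g:=q_1+q_2$: $$s_1:( * )\mapsto\left(q_1+\frac{\alpha_2}{p_1},\,p_1,\,q_2,\,p_2,\,t,\,s;\ \alpha_1+2\alpha_2,\,-\alpha_2,\,\alpha_3\right),$$ $$s_2:( * )\mapsto\left(q_1,\,p_1,\,q_2+\frac{\alpha_3}{p_2},\,p_2,\,t,\,s;\ \alpha_1+\alpha_3,\,\alpha_2,\,-\alpha_3\right),$$ $$s_3:( * )\mapsto(Q_1,P_1,Q_2,P_2,t,s;\ -\alpha_1-\alpha_3,\ 2\alpha_1+\alpha_2+\alpha_3,\ \alpha_3),$$ with $$Q_1=\frac{q_1f-gp_2+\alpha_1}{f},\qquad P_1=p_1-q_1^2-p_2+\frac{(q_1f-gp_2+\alpha_1)^2}{f^2}-\frac{g(-gp_2+2\alpha_1+2\alpha_2)}{f},$$ $$Q_2=-\frac{f}{g}-\frac{q_1f-gp_2+\alpha_1}{f},\qquad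 P_2=-\frac{g(-gp_2+2\alpha_1+2\alpha_2)}{f}.$$
   Context: The polynomials are $$K_1=q_1^2p_1-p_1^2+\alpha_2q_1-\frac{q_2^2p_2}{2}-\frac{p_2^2}{2}-\frac{\alpha_3}{2}q_2+\frac32p_1p_2,$$ $$\begin{aligned}K_2=&-\alpha_3^2p_1+q_2^4p_2^2+2q_2^2p_2^3+p_2^4+2\alpha_3q_2^3p_2+4(\alpha_1+\alpha_3)q_2p_2^2+\alpha_3^2q_2^2+\alpha_3(2\alpha_1+\alpha_3)p_2\\&-p_2\big(8q_1p_1q_2p_2+6p_1q_2^2p_2+4q_1^2p_1p_2+2p_1p_2^2-p_1^2p_2+4\alpha_2q_1p_2+4\alpha_3q_1p_1+6\alpha_3p_1q_2\big).\end{aligned}$$ "Invariant" means that each transformation carries solutions of the system with parameters $(\alpha_1,\alpha_2,\alpha_3)$ (on which it is defined) to solutions of the same system with the transformed parameters. "Symplectic" means preserving the 2-form $dq_1\wedge dp_1+dq_2\wedge dp_2$. *)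

theory Defs
  imports "HOL-Analysis.Analysis"
begin

text \<open>
  Points of phase space are \<open>(q\<^sub>1, p\<^sub>1, q\<^sub>2, p\<^sub>2)\<close>, times are \<open>(t, s)\<close> and parameters are
  \<open>(\<alpha>\<^sub>1, \<alpha>\<^sub>2, \<alpha>\<^sub>3)\<close>; all coordinates are complex.
\<close>

type_synonym phase = "complex \<times> complex \<times> complex \<times> complex"
type_synonym times = "complex \<times> complex"
type_synonym params = "complex \<times> complex \<times> complex"

definition param_space :: "params set" where
  "param_space = {(\<alpha>\<^sub>1, \<alpha>\<^sub>2, \<alpha>\<^sub>3). 2 * \<alpha>\<^sub>1 + 2 * \<alpha>\<^sub>2 + \<alpha>\<^sub>3 = 0}"

subsection \<open>The Hamiltonian system\<close>

fun K1 :: "params \<Rightarrow> phase \<Rightarrow> complex" where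
  "K1 (\<alpha>\<^sub>1, \<alpha>\<^sub>2, \<alpha>\<^sub>3) (q\<^sub>1, p\<^sub>1, q\<^sub>2, p\<^sub>2) =
     q\<^sub>1^2 * p\<^sub>1 - p\<^sub>1^2 + \<alpha>\<^sub>2 * q\<^sub>1 - q\<^sub>2^2 * p\<^sub>2 / 2 - p\<^sub>2^2 / 2 - \<alpha>\<^sub>3 / 2 * q\<^sub>2
     + 3 / 2 * p\<^sub>1 * p\<^sub>2"

fun K2 :: "params \<Rightarrow> phase \<Rightarrow> complex" where
  "K2 (\<alpha>\<^sub>1, \<alpha>\<^sub>2, \<alpha>\<^sub>3) (q\<^sub>1, p\<^sub>1, q\<^sub>2, p\<^sub>2) =
     - (\<alpha>\<^sub>3^2 * p\<^sub>1) + q\<^sub>2^4 * p\<^sub>2^2 + 2 * q\<^sub>2^2 * p\<^sub>2^3 + p\<^sub>2^4 + 2 * \<alpha>\<^sub>3 * q\<^sub>2^3 * p\<^sub>2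
     + 4 * (\<alpha>\<^sub>1 + \<alpha>\<^sub>3) * q\<^sub>2 * p\<^sub>2^2 + \<alpha>\<^sub>3^2 * q\<^sub>2^2 + \<alpha>\<^sub>3 * (2 * \<alpha>\<^sub>1 + \<alpha>\<^sub>3) * p\<^sub>2
     - p\<^sub>2 * (8 * q\<^sub>1 * p\<^sub>1 * q\<^sub>2 * p\<^sub>2 + 6 * p\<^sub>1 * q\<^sub>2^2 * p\<^sub>2 + 4 * q\<^sub>1^2 * p\<^sub>1 * p\<^sub>2
         + 2 * p\<^sub>1 * p\<^sub>2^2 - p\<^sub>1^2 * p\<^sub>2 + 4 * \<alpha>\<^sub>2 * q\<^sub>1 * p\<^sub>2 + 4 * \<alpha>\<^sub>3 * q\<^sub>1 * p\<^sub>1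
         + 6 * \<alpha>\<^sub>3 * p\<^sub>1 * q\<^sub>2)"

fun d_q1 :: "(phase \<Rightarrow> complex) \<Rightarrow> phase \<Rightarrow> complex" where
  "d_q1 H (q\<^sub>1, p\<^sub>1, q\<^sub>2, p\<^sub>2) = deriv (\<lambda>z. H (z, p\<^sub>1, q\<^sub>2, p\<^sub>2)) q\<^sub>1"

fun d_p1 :: "(phase \<Rightarrow> complex) \<Rightarrow> phase \<Rightarrow> complex" where
  "d_p1 H (q\<^sub>1, p\<^sub>1, q\<^sub>2, p\<^sub>2) = deriv (\<lambda>z. H (q\<^sub>1, z, q\<^sub>2, p\<^sub>2)) p\<^sub>1"

fun d_q2 :: "(phase \<Rightarrow> complex) \<Rightarrow> phase \<Rightarrow> complex" where
  "d_q2 H (q\<^sub>1, p\<^sub>1, q\<^sub>2, p\<^sub>2) = deriv (\<lambda>z. H (q\<^sub>1, p\<^sub>1, z, p\<^sub>2)) q\<^sub>2"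

fun d_p2 :: "(phase \<Rightarrow> complex) \<Rightarrow> phase \<Rightarrow> complex" where
  "d_p2 H (q\<^sub>1, p\<^sub>1, q\<^sub>2, p\<^sub>2) = deriv (\<lambda>z. H (q\<^sub>1, p\<^sub>1, q\<^sub>2, z)) p\<^sub>2"

text \<open>
  The total differential equation \<open>dy = A dt + B ds\<close> says that the Frechet derivative of \<open>y\<close> is
  \<open>(dt, ds) \<mapsto> A dt + B ds\<close>. This map is complex linear, so solutions are holomorphic functions of
  \<open>(t, s)\<close> on the open set \<open>U\<close>.
\<close>

definition is_solution ::
  "params \<Rightarrow> times set \<Rightarrow> (times \<Rightarrow> complex) \<Rightarrow> (times \<Rightarrow> complex) \<Rightarrow> (times \<Rightarrow> complex)
    \<Rightarrow> (times \<Rightarrow> complex) \<Rightarrow> bool" where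
  "is_solution \<alpha> U q\<^sub>1 p\<^sub>1 q\<^sub>2 p\<^sub>2 \<longleftrightarrow>
     open U \<and>
     (\<forall>u\<in>U. let x = (q\<^sub>1 u, p\<^sub>1 u, q\<^sub>2 u, p\<^sub>2 u) in
        (q\<^sub>1 has_derivative (\<lambda>(dt, ds). d_p1 (K1 \<alpha>) x * dt + d_p1 (K2 \<alpha>) x * ds)) (at u) \<and>
        (p\<^sub>1 has_derivative (\<lambda>(dt, ds). - d_q1 (K1 \<alpha>) x * dt - d_q1 (K2 \<alpha>) x * ds)) (at u) \<and>
        (q\<^sub>2 has_derivative (\<lambda>(dt, ds). d_p2 (K1 \<alpha>) x * dt + d_p2 (K2 \<alpha>) x * ds)) (at u) \<and>
        (p\<^sub>2 has_derivative (\<lambda>(dt, ds). - d_q2 (K1 \<alpha>) x * dt - d_q2 (K2 \<alpha>) x * ds)) (at u))"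

subsection \<open>Transformations, invariance\<close>

text \<open>Transformations are partial maps: \<open>None\<close> where a denominator vanishes.\<close>

type_synonym state = "phase \<times> times \<times> params"

fun s1 :: "state \<rightharpoonup> state" where
  "s1 ((q\<^sub>1, p\<^sub>1, q\<^sub>2, p\<^sub>2), (t, s), (\<alpha>\<^sub>1, \<alpha>\<^sub>2, \<alpha>\<^sub>3)) =
     (if p\<^sub>1 = 0 then None
      else Some ((q\<^sub>1 + \<alpha>\<^sub>2 / p\<^sub>1, p\<^sub>1, q\<^sub>2, p\<^sub>2), (t, s), (\<alpha>\<^sub>1 + 2 * \<alpha>\<^sub>2, - \<alpha>\<^sub>2, \<alpha>\<^sub>3)))"

fun s2 :: "state \<rightharpoonup> state" where
  "s2 ((q\<^sub>1, p\<^sub>1, q\<^sub>2, p\<^sub>2), (t, s), (\<alpha>\<^sub>1, \<alpha>\<^sub>2, \<alpha>\<^sub>3)) =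
     (if p\<^sub>2 = 0 then None
      else Some ((q\<^sub>1, p\<^sub>1, q\<^sub>2 + \<alpha>\<^sub>3 / p\<^sub>2, p\<^sub>2), (t, s), (\<alpha>\<^sub>1 + \<alpha>\<^sub>3, \<alpha>\<^sub>2, - \<alpha>\<^sub>3)))"

fun s3 :: "state \<rightharpoonup> state" where
  "s3 ((q\<^sub>1, p\<^sub>1, q\<^sub>2, p\<^sub>2), (t, s), (\<alpha>\<^sub>1, \<alpha>\<^sub>2, \<alpha>\<^sub>3)) =
     (let f = p\<^sub>1 - q\<^sub>1^2 - p\<^sub>2;
          g = q\<^sub>1 + q\<^sub>2;
          Q\<^sub>1 = (q\<^sub>1 * f - g * p\<^sub>2 + \<alpha>\<^sub>1) / f;
          P\<^sub>1 = p\<^sub>1 - q\<^sub>1^2 - p\<^sub>2 + (q\<^sub>1 * f - g * p\<^sub>2 + \<alpha>\<^sub>1)^2 / f^2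
               - g * (- g * p\<^sub>2 + 2 * \<alpha>\<^sub>1 + 2 * \<alpha>\<^sub>2) / f;
          Q\<^sub>2 = - f / g - (q\<^sub>1 * f - g * p\<^sub>2 + \<alpha>\<^sub>1) / f;
          P\<^sub>2 = - (g * (- g * p\<^sub>2 + 2 * \<alpha>\<^sub>1 + 2 * \<alpha>\<^sub>2) / f)
      in if f = 0 \<or> g = 0 then None
         else Some ((Q\<^sub>1, P\<^sub>1, Q\<^sub>2, P\<^sub>2), (t, s),
                    (- \<alpha>\<^sub>1 - \<alpha>\<^sub>3, 2 * \<alpha>\<^sub>1 + \<alpha>\<^sub>2 + \<alpha>\<^sub>3, \<alpha>\<^sub>3)))"

text \<open>
  \<open>S\<close> carries solutions for \<open>\<alpha>\<close> to solutions for \<open>\<beta>\<close>: applied along the graph of a solution lying in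
  its domain of definition, it yields the graph of a solution over the same times.
\<close>

definition carries_solutions :: "(state \<rightharpoonup> state) \<Rightarrow> params \<Rightarrow> params \<Rightarrow> bool" where
  "carries_solutions S \<alpha> \<beta> \<longleftrightarrow>
     (\<forall>U q\<^sub>1 p\<^sub>1 q\<^sub>2 p\<^sub>2.
        is_solution \<alpha> U q\<^sub>1 p\<^sub>1 q\<^sub>2 p\<^sub>2 \<and>
        (\<forall>u\<in>U. ((q\<^sub>1 u, p\<^sub>1 u, q\<^sub>2 u, p\<^sub>2 u), u, \<alpha>) \<in> dom S) \<longrightarrow>
        (\<exists>Q\<^sub>1 P\<^sub>1 Q\<^sub>2 P\<^sub>2.
           is_solution \<beta> U Q\<^sub>1 P\<^sub>1 Q\<^sub>2 P\<^sub>2 \<and>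
           (\<forall>u\<in>U. S ((q\<^sub>1 u, p\<^sub>1 u, q\<^sub>2 u, p\<^sub>2 u), u, \<alpha>) =
                    Some ((Q\<^sub>1 u, P\<^sub>1 u, Q\<^sub>2 u, P\<^sub>2 u), u, \<beta>))))"

definition phase_map :: "(state \<rightharpoonup> state) \<Rightarrow> times \<Rightarrow> params \<Rightarrow> (phase \<rightharpoonup> phase)" where
  "phase_map S u \<alpha> x = map_option fst (S (x, u, \<alpha>))"

subsection \<open>Birational maps of the phase space\<close>

text \<open>
  As the complex field is infinite, polynomials in \<open>q\<^sub>1, p\<^sub>1, q\<^sub>2, p\<^sub>2\<close> are identified with the
  functions they induce.
\<close>

inductive polynomial_fun :: "(phase \<Rightarrow> complex) \<Rightarrow> bool" where
  const: "polynomial_fun (\<lambda>x. c)"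
| q1: "polynomial_fun (\<lambda>(q\<^sub>1, p\<^sub>1, q\<^sub>2, p\<^sub>2). q\<^sub>1)"
| p1: "polynomial_fun (\<lambda>(q\<^sub>1, p\<^sub>1, q\<^sub>2, p\<^sub>2). p\<^sub>1)"
| q2: "polynomial_fun (\<lambda>(q\<^sub>1, p\<^sub>1, q\<^sub>2, p\<^sub>2). q\<^sub>2)"
| p2: "polynomial_fun (\<lambda>(q\<^sub>1, p\<^sub>1, q\<^sub>2, p\<^sub>2). p\<^sub>2)"
| add: "polynomial_fun f \<Longrightarrow> polynomial_fun g \<Longrightarrow> polynomial_fun (\<lambda>x. f x + g x)"
| mult: "polynomial_fun f \<Longrightarrow> polynomial_fun g \<Longrightarrow> polynomial_fun (\<lambda>x. f x * g x)"

definition rational_fun :: "(phase \<rightharpoonup> complex) \<Rightarrow> bool" where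
  "rational_fun r \<longleftrightarrow>
     (\<exists>N D. polynomial_fun N \<and> polynomial_fun D \<and> (\<exists>x. D x \<noteq> 0) \<and>
        r = (\<lambda>x. if D x = 0 then None else Some (N x / D x)))"

definition rational_map :: "(phase \<rightharpoonup> phase) \<Rightarrow> bool" where
  "rational_map F \<longleftrightarrow>
     (\<exists>r\<^sub>1 r\<^sub>2 r\<^sub>3 r\<^sub>4.
        rational_fun r\<^sub>1 \<and> rational_fun r\<^sub>2 \<and> rational_fun r\<^sub>3 \<and> rational_fun r\<^sub>4 \<and>
        F = (\<lambda>x. case (r\<^sub>1 x, r\<^sub>2 x, r\<^sub>3 x, r\<^sub>4 x) of
                   (Some a, Some b, Some c, Some d) \<Rightarrow> Some (a, b, c, d)
                 | _ \<Rightarrow> None))"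

text \<open>
  \<open>G \<circ> F = id\<close> as rational maps: the composite is defined somewhere, hence on a dense Zariski-open
  set, and is the identity wherever it is defined.
\<close>

definition rational_left_inverse :: "(phase \<rightharpoonup> phase) \<Rightarrow> (phase \<rightharpoonup> phase) \<Rightarrow> bool" where
  "rational_left_inverse G F \<longleftrightarrow>
     dom (G \<circ>\<^sub>m F) \<noteq> {} \<and> (\<forall>x\<in>dom (G \<circ>\<^sub>m F). (G \<circ>\<^sub>m F) x = Some x)"

definition birational :: "(phase \<rightharpoonup> phase) \<Rightarrow> bool" where
  "birational F \<longleftrightarrow>
     rational_map F \<and>
     (\<exists>G. rational_map G \<and> rational_left_inverse G F \<and> rational_left_inverse F G)"

subsection \<open>Symplectic maps\<close>

text \<open>The 2-form \<open>dq\<^sub>1 \<and> dp\<^sub>1 + dq\<^sub>2 \<and> dp\<^sub>2\<close>, evaluated on a pair of tangent vectors.\<close>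

fun symplectic_form :: "phase \<Rightarrow> phase \<Rightarrow> complex" where
  "symplectic_form (a\<^sub>1, b\<^sub>1, a\<^sub>2, b\<^sub>2) (c\<^sub>1, d\<^sub>1, c\<^sub>2, d\<^sub>2) =
     (a\<^sub>1 * d\<^sub>1 - b\<^sub>1 * c\<^sub>1) + (a\<^sub>2 * d\<^sub>2 - b\<^sub>2 * c\<^sub>2)"

definition symplectic :: "(phase \<rightharpoonup> phase) \<Rightarrow> bool" where
  "symplectic F \<longleftrightarrow>
     open (dom F) \<and>
     (\<forall>x\<in>dom F. \<exists>F'.
        ((\<lambda>x. the (F x)) has_derivative F') (at x) \<and>
        (\<forall>v w. symplectic_form (F' v) (F' w) = symplectic_form v w))"

definition invariant_birational_symplectic :: "(state \<rightharpoonup> state) \<Rightarrow> params \<Rightarrow> params \<Rightarrow> bool" where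
  "invariant_birational_symplectic S \<alpha> \<beta> \<longleftrightarrow>
     \<beta> \<in> param_space \<and> carries_solutions S \<alpha> \<beta> \<and>
     (\<forall>u. birational (phase_map S u \<alpha>) \<and> symplectic (phase_map S u \<alpha>))"

end

theory Submission
  imports Defs
begin

text \<open>
  Along a solution with values \<open>x\<close>, the total differential equation says that the tangent vector
  \<open>X\<close> in the direction \<open>(dt, ds)\<close> is determined by \<open>\<omega>(X, v) = dt * dK\<^sub>1(v) + ds * dK\<^sub>2(v)\<close> for all
  \<open>v\<close>, where \<open>\<omega>\<close> is the symplectic form. A map that preserves \<open>\<omega>\<close> and takes \<open>K\<^sub>1, K\<^sub>2\<close> to
  the Hamiltonians with the new parameters therefore takes solutions to solutions: both sides of
  this characterization are transported (\<open>symplectic_maps_flow_differential\<close>,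
  \<open>carries_solutionsI\<close>).

  Each of the three maps is undone by the same formula with the transformed parameters. It is then
  birational as soon as it is rational and maps its domain into itself. This leaves, for each map,
  three algebraic facts: inversion, preservation of \<open>\<omega>\<close>, and invariance of \<open>K\<^sub>1\<close> and \<open>K\<^sub>2\<close>
  (\<open>invariant_birational_symplecticI\<close>). The values of \<open>K\<^sub>1\<close> and \<open>K\<^sub>2\<close> are preserved exactly, not
  merely up to an additive constant.

  For \<open>s\<^sub>1\<close> and \<open>s\<^sub>2\<close> these facts are short calculations, as one coordinate is shifted by a function
  of its conjugate. For \<open>s\<^sub>3\<close>, the functions \<open>q\<^sub>1, f, g, p\<^sub>2\<close> are canonical coordinates: the form is
  \<open>dq\<^sub>1 \<and> df + dg \<and> dp\<^sub>2\<close>. With \<open>w = g * p\<^sub>2\<close> and the relation between the parameters, \<open>s\<^sub>3\<close> becomes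
  \<open>f \<mapsto> f\<close>, \<open>g \<mapsto> - f / g\<close>, \<open>w \<mapsto> - w - \<alpha>\<^sub>3\<close>, \<open>q\<^sub>1 \<mapsto> q\<^sub>1 - (w - \<alpha>\<^sub>1) / f\<close>. As
  \<open>dg \<and> dp\<^sub>2 = dlog g \<and> dw\<close>, the new second summand is \<open>dlog g \<and> dw - dlog f \<and> dw\<close>, and the shift of
  \<open>q\<^sub>1\<close> produces the compensating \<open>dlog f \<and> dw\<close> in the first.
\<close>

section \<open>Polynomial functions and their differentials\<close>

text \<open>
  The inductive rules for sums and products do not match a function written as one abstraction
  over a tuple. The following variants do, so that polynomiality of an explicit expression can be read
  off from its syntax.
\<close>

lemma polynomial_fun_add_tuple:
  assumes "polynomial_fun (\<lambda>(q\<^sub>1, p\<^sub>1, q\<^sub>2, p\<^sub>2). f q\<^sub>1 p\<^sub>1 q\<^sub>2 p\<^sub>2)"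
    and "polynomial_fun (\<lambda>(q\<^sub>1, p\<^sub>1, q\<^sub>2, p\<^sub>2). g q\<^sub>1 p\<^sub>1 q\<^sub>2 p\<^sub>2)"
  shows "polynomial_fun (\<lambda>(q\<^sub>1, p\<^sub>1, q\<^sub>2, p\<^sub>2). f q\<^sub>1 p\<^sub>1 q\<^sub>2 p\<^sub>2 + g q\<^sub>1 p\<^sub>1 q\<^sub>2 p\<^sub>2)"
  using polynomial_fun.add[OF assms] by (simp add: case_prod_unfold)

lemma polynomial_fun_mult_tuple:
  assumes "polynomial_fun (\<lambda>(q\<^sub>1, p\<^sub>1, q\<^sub>2, p\<^sub>2). f q\<^sub>1 p\<^sub>1 q\<^sub>2 p\<^sub>2)"
    and "polynomial_fun (\<lambda>(q\<^sub>1, p\<^sub>1, q\<^sub>2, p\<^sub>2). g q\<^sub>1 p\<^sub>1 q\<^sub>2 p\<^sub>2)"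
  shows "polynomial_fun (\<lambda>(q\<^sub>1, p\<^sub>1, q\<^sub>2, p\<^sub>2). f q\<^sub>1 p\<^sub>1 q\<^sub>2 p\<^sub>2 * g q\<^sub>1 p\<^sub>1 q\<^sub>2 p\<^sub>2)"
  using polynomial_fun.mult[OF assms] by (simp add: case_prod_unfold)

lemma polynomial_fun_const_tuple: "polynomial_fun (\<lambda>(q\<^sub>1, p\<^sub>1, q\<^sub>2, p\<^sub>2). c)"
  using polynomial_fun.const[of c] by (simp add: case_prod_unfold)

lemma polynomial_fun_minus_tuple:
  assumes "polynomial_fun (\<lambda>(q\<^sub>1, p\<^sub>1, q\<^sub>2, p\<^sub>2). f q\<^sub>1 p\<^sub>1 q\<^sub>2 p\<^sub>2)"
  shows "polynomial_fun (\<lambda>(q\<^sub>1, p\<^sub>1, q\<^sub>2, p\<^sub>2). - f q\<^sub>1 p\<^sub>1 q\<^sub>2 p\<^sub>2)"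
  using polynomial_fun_mult_tuple[OF polynomial_fun_const_tuple[of "-1"] assms] by simp

lemma polynomial_fun_diff_tuple:
  assumes "polynomial_fun (\<lambda>(q\<^sub>1, p\<^sub>1, q\<^sub>2, p\<^sub>2). f q\<^sub>1 p\<^sub>1 q\<^sub>2 p\<^sub>2)"
    and "polynomial_fun (\<lambda>(q\<^sub>1, p\<^sub>1, q\<^sub>2, p\<^sub>2). g q\<^sub>1 p\<^sub>1 q\<^sub>2 p\<^sub>2)"
  shows "polynomial_fun (\<lambda>(q\<^sub>1, p\<^sub>1, q\<^sub>2, p\<^sub>2). f q\<^sub>1 p\<^sub>1 q\<^sub>2 p\<^sub>2 - g q\<^sub>1 p\<^sub>1 q\<^sub>2 p\<^sub>2)"
  using polynomial_fun_add_tuple[OF assms(1) polynomial_fun_minus_tuple[OF assms(2)]] by simp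

lemma polynomial_fun_divide_tuple:
  assumes "polynomial_fun (\<lambda>(q\<^sub>1, p\<^sub>1, q\<^sub>2, p\<^sub>2). f q\<^sub>1 p\<^sub>1 q\<^sub>2 p\<^sub>2)"
  shows "polynomial_fun (\<lambda>(q\<^sub>1, p\<^sub>1, q\<^sub>2, p\<^sub>2). f q\<^sub>1 p\<^sub>1 q\<^sub>2 p\<^sub>2 / c)"
  using polynomial_fun_mult_tuple[OF assms polynomial_fun_const_tuple[of "inverse c"]]
  by (simp add: divide_inverse)

lemma polynomial_fun_power_tuple:
  assumes "polynomial_fun (\<lambda>(q\<^sub>1, p\<^sub>1, q\<^sub>2, p\<^sub>2). f q\<^sub>1 p\<^sub>1 q\<^sub>2 p\<^sub>2)"
  shows "polynomial_fun (\<lambda>(q\<^sub>1, p\<^sub>1, q\<^sub>2, p\<^sub>2). f q\<^sub>1 p\<^sub>1 q\<^sub>2 p\<^sub>2 ^ n)"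
proof (induction n)
  case 0
  show ?case using polynomial_fun_const_tuple[of 1] by (simp add: case_prod_unfold)
next
  case (Suc n)
  from polynomial_fun_mult_tuple[OF assms this] show ?case by simp
qed

lemmas polynomial_fun_intros =
  polynomial_fun_const_tuple polynomial_fun.q1 polynomial_fun.p1 polynomial_fun.q2
  polynomial_fun.p2 polynomial_fun_minus_tuple polynomial_fun_add_tuple
  polynomial_fun_diff_tuple polynomial_fun_mult_tuple polynomial_fun_divide_tuple
  polynomial_fun_power_tuple

lemma polynomial_fun_K1: "polynomial_fun (K1 \<alpha>)"
proof -
  obtain \<alpha>\<^sub>1 \<alpha>\<^sub>2 \<alpha>\<^sub>3 where \<alpha>: "\<alpha> = (\<alpha>\<^sub>1, \<alpha>\<^sub>2, \<alpha>\<^sub>3)" by (cases \<alpha>)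
  have "K1 \<alpha> = (\<lambda>(q\<^sub>1, p\<^sub>1, q\<^sub>2, p\<^sub>2). K1 (\<alpha>\<^sub>1, \<alpha>\<^sub>2, \<alpha>\<^sub>3) (q\<^sub>1, p\<^sub>1, q\<^sub>2, p\<^sub>2))"
    by (auto simp: \<alpha>)
  then show ?thesis
    unfolding K1.simps by (simp only:) (intro polynomial_fun_intros)
qed

lemma polynomial_fun_K2: "polynomial_fun (K2 \<alpha>)"
proof -
  obtain \<alpha>\<^sub>1 \<alpha>\<^sub>2 \<alpha>\<^sub>3 where \<alpha>: "\<alpha> = (\<alpha>\<^sub>1, \<alpha>\<^sub>2, \<alpha>\<^sub>3)" by (cases \<alpha>)
  have "K2 \<alpha> = (\<lambda>(q\<^sub>1, p\<^sub>1, q\<^sub>2, p\<^sub>2). K2 (\<alpha>\<^sub>1, \<alpha>\<^sub>2, \<alpha>\<^sub>3) (q\<^sub>1, p\<^sub>1, q\<^sub>2, p\<^sub>2))"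
    by (auto simp: \<alpha>)
  then show ?thesis
    unfolding K2.simps by (simp only:) (intro polynomial_fun_intros)
qed

definition differential :: "(phase \<Rightarrow> complex) \<Rightarrow> phase \<Rightarrow> phase \<Rightarrow> complex" where
  "differential H x = (\<lambda>(a\<^sub>1, b\<^sub>1, a\<^sub>2, b\<^sub>2).
     d_q1 H x * a\<^sub>1 + d_p1 H x * b\<^sub>1 + d_q2 H x * a\<^sub>2 + d_p2 H x * b\<^sub>2)"

text \<open>
  The induction provides only some complex linear derivative; that its coefficients are the
  partial derivatives follows afterwards by restricting to the coordinate lines.
\<close>

lemma polynomial_fun_has_complex_linear_derivative:
  assumes "polynomial_fun H"
  shows "\<exists>A B C D. (H has_derivative (\<lambda>(a, b, c, d). A * a + B * b + C * c + D * d)) (at x)"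
  using assms
proof induction
  case (const c)
  show ?case
    by (rule exI[of _ 0])+ (simp add: case_prod_unfold)
next
  case q1
  have "((\<lambda>x. fst x) has_derivative (\<lambda>v. fst v)) (at x)"
    by (intro derivative_intros)
  then show ?case
    by (intro exI[of _ 1] exI[of _ 0]) (simp add: case_prod_unfold)
next
  case p1
  have "((\<lambda>x. fst (snd x)) has_derivative (\<lambda>v. fst (snd v))) (at x)"
    by (intro derivative_intros)
  then show ?case
    by (intro exI[of _ 0] exI[of _ 1] exI[of _ 0]) (simp add: case_prod_unfold)
next
  case q2
  have "((\<lambda>x. fst (snd (snd x))) has_derivative (\<lambda>v. fst (snd (snd v)))) (at x)"
    by (intro derivative_intros)
  then show ?case
    by (intro exI[of _ 0] exI[of _ 1] exI[of _ 0]) (simp add: case_prod_unfold)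
next
  case p2
  have "((\<lambda>x. snd (snd (snd x))) has_derivative (\<lambda>v. snd (snd (snd v)))) (at x)"
    by (intro derivative_intros)
  then show ?case
    by (intro exI[of _ 0] exI[of _ 1]) (simp add: case_prod_unfold)
next
  case (add f g)
  then obtain A B C D A' B' C' D'
    where "(f has_derivative (\<lambda>(a, b, c, d). A * a + B * b + C * c + D * d)) (at x)"
      and "(g has_derivative (\<lambda>(a, b, c, d). A' * a + B' * b + C' * c + D' * d)) (at x)"
    by blast
  from has_derivative_add[OF this] show ?case
    by (intro exI[of _ "A + A'"] exI[of _ "B + B'"] exI[of _ "C + C'"] exI[of _ "D + D'"])
       (simp add: case_prod_unfold algebra_simps)
next
  case (mult f g)
  then obtain A B C D A' B' C' D'
    where "(f has_derivative (\<lambda>(a, b, c, d). A * a + B * b + C * c + D * d)) (at x)"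
      and "(g has_derivative (\<lambda>(a, b, c, d). A' * a + B' * b + C' * c + D' * d)) (at x)"
    by blast
  from has_derivative_mult[OF this] show ?case
    by (intro exI[of _ "f x * A' + A * g x"] exI[of _ "f x * B' + B * g x"]
          exI[of _ "f x * C' + C * g x"] exI[of _ "f x * D' + D * g x"])
       (simp add: case_prod_unfold algebra_simps)
qed

lemma polynomial_fun_has_derivative:
  assumes "polynomial_fun H"
  shows "(H has_derivative differential H x) (at x)"
proof -
  obtain q\<^sub>1 p\<^sub>1 q\<^sub>2 p\<^sub>2 where x: "x = (q\<^sub>1, p\<^sub>1, q\<^sub>2, p\<^sub>2)" by (cases x)
  obtain A B C D where
    H: "(H has_derivative (\<lambda>(a, b, c, d). A * a + B * b + C * c + D * d)) (at x)"
    using polynomial_fun_has_complex_linear_derivative[OF assms] by blast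
  have line: "deriv (\<lambda>z. H (\<gamma> z)) z\<^sub>0 = c"
    if "\<gamma> z\<^sub>0 = x" "(\<gamma> has_derivative \<gamma>') (at z\<^sub>0)"
      "\<And>h. (case \<gamma>' h of (a, b, c, d) \<Rightarrow> A * a + B * b + C * c + D * d) = c * h" for \<gamma> z\<^sub>0 \<gamma>' c
  proof (rule DERIV_imp_deriv)
    have "((\<lambda>z. H (\<gamma> z)) has_derivative
        (\<lambda>h. case \<gamma>' h of (a, b, c, d) \<Rightarrow> A * a + B * b + C * c + D * d)) (at z\<^sub>0)"
      using has_derivative_compose[OF that(2)] H that(1) by simp
    then show "((\<lambda>z. H (\<gamma> z)) has_field_derivative c) (at z\<^sub>0)"
      by (simp add: that(3) has_field_derivative_def)
  qed
  have "d_q1 H x = A"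
    unfolding x d_q1.simps
    by (rule line[where \<gamma>' = "\<lambda>h. (h, 0, 0, 0)"]) (auto simp: x zero_prod_def intro!: derivative_eq_intros)
  moreover have "d_p1 H x = B"
    unfolding x d_p1.simps
    by (rule line[where \<gamma>' = "\<lambda>h. (0, h, 0, 0)"]) (auto simp: x zero_prod_def intro!: derivative_eq_intros)
  moreover have "d_q2 H x = C"
    unfolding x d_q2.simps
    by (rule line[where \<gamma>' = "\<lambda>h. (0, 0, h, 0)"]) (auto simp: x zero_prod_def intro!: derivative_eq_intros)
  moreover have "d_p2 H x = D"
    unfolding x d_p2.simps
    by (rule line[where \<gamma>' = "\<lambda>h. (0, 0, 0, h)"]) (auto simp: x zero_prod_def intro!: derivative_eq_intros)
  ultimately show ?thesis using H by (simp add: differential_def)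
qed

section \<open>Rational maps\<close>

text \<open>
  With a common denominator, each component is undefined exactly where the whole map is, so no
  intersection of domains has to be computed.
\<close>

lemma rational_map_common_denominator:
  assumes "polynomial_fun N\<^sub>1" "polynomial_fun N\<^sub>2" "polynomial_fun N\<^sub>3" "polynomial_fun N\<^sub>4"
    and "polynomial_fun D" "D x\<^sub>0 \<noteq> 0"
    and "\<And>x. F x = (if D x = 0 then None
                    else Some (N\<^sub>1 x / D x, N\<^sub>2 x / D x, N\<^sub>3 x / D x, N\<^sub>4 x / D x))"
  shows "rational_map F"
proof -
  have "rational_fun (\<lambda>x. if D x = 0 then None else Some (N x / D x))"
    if "polynomial_fun N" for N
    unfolding rational_fun_def using that assms(5,6) by blast
  then show ?thesis
    unfolding rational_map_def using assms(1-4)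
    by (intro exI[of _ "\<lambda>x. if D x = 0 then None else Some (N\<^sub>1 x / D x)"]
        exI[of _ "\<lambda>x. if D x = 0 then None else Some (N\<^sub>2 x / D x)"]
        exI[of _ "\<lambda>x. if D x = 0 then None else Some (N\<^sub>3 x / D x)"]
        exI[of _ "\<lambda>x. if D x = 0 then None else Some (N\<^sub>4 x / D x)"])
      (auto simp: assms(7) fun_eq_iff)
qed

lemma rational_left_inverseI:
  assumes "dom F \<noteq> {}" and "\<And>x y. F x = Some y \<Longrightarrow> G y = Some x"
  shows "rational_left_inverse G F"
  using assms unfolding rational_left_inverse_def
  by (fastforce simp: map_comp_def dom_def split: option.splits)

section \<open>Symplectic maps and solutions\<close>

text \<open>
  The right-hand side of the system at \<open>x\<close>, as a linear map from time increments to tangent vectors.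
\<close>

definition flow_differential :: "params \<Rightarrow> phase \<Rightarrow> times \<Rightarrow> phase" where
  "flow_differential \<alpha> x = (\<lambda>(dt, ds).
     (d_p1 (K1 \<alpha>) x * dt + d_p1 (K2 \<alpha>) x * ds, - d_q1 (K1 \<alpha>) x * dt - d_q1 (K2 \<alpha>) x * ds,
      d_p2 (K1 \<alpha>) x * dt + d_p2 (K2 \<alpha>) x * ds, - d_q2 (K1 \<alpha>) x * dt - d_q2 (K2 \<alpha>) x * ds))"

lemma is_solution_iff:
  "is_solution \<alpha> U q\<^sub>1 p\<^sub>1 q\<^sub>2 p\<^sub>2 \<longleftrightarrow> open U \<and>
     (\<forall>u\<in>U. ((\<lambda>u. (q\<^sub>1 u, p\<^sub>1 u, q\<^sub>2 u, p\<^sub>2 u)) has_derivative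
        flow_differential \<alpha> (q\<^sub>1 u, p\<^sub>1 u, q\<^sub>2 u, p\<^sub>2 u)) (at u))"
proof -
  have pair: "((\<lambda>u. (a u, b u, c u, d u)) has_derivative (\<lambda>v. (a' v, b' v, c' v, d' v))) (at u)
    \<longleftrightarrow> (a has_derivative a') (at u) \<and> (b has_derivative b') (at u) \<and>
       (c has_derivative c') (at u) \<and> (d has_derivative d') (at u)"
    (is "?T \<longleftrightarrow> ?C")
    for a b c d a' b' c' d' :: "times \<Rightarrow> complex" and u
  proof
    assume T: ?T
    show ?C
      using has_derivative_fst[OF T] has_derivative_fst[OF has_derivative_snd[OF T]]
        has_derivative_fst[OF has_derivative_snd[OF has_derivative_snd[OF T]]]
        has_derivative_snd[OF has_derivative_snd[OF has_derivative_snd[OF T]]]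
      by simp
  qed (auto intro!: derivative_intros)
  show ?thesis
    unfolding is_solution_def flow_differential_def
    by (simp add: Let_def case_prod_unfold pair)
qed

text \<open>
  The coordinate-free form of Hamilton's equations: as \<open>\<omega>\<close> is nondegenerate, these pairings determine
  the tangent vector.
\<close>

lemma symplectic_form_flow_differential:
  "symplectic_form (flow_differential \<alpha> x (dt, ds)) v =
     dt * differential (K1 \<alpha>) x v + ds * differential (K2 \<alpha>) x v"
  by (cases v) (simp add: flow_differential_def differential_def algebra_simps)

lemma symplectic_form_nondegenerate:
  assumes "\<And>w. symplectic_form v w = symplectic_form v' w"
  shows "v = v'"
proof -
  obtain a b c d where v: "v = (a, b, c, d)" by (cases v)
  obtain a' b' c' d' where v': "v' = (a', b', c', d')" by (cases v')
  show ?thesis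
    using assms[of "(1,0,0,0)"] assms[of "(0,1,0,0)"] assms[of "(0,0,1,0)"] assms[of "(0,0,0,1)"]
    by (simp add: v v')
qed

lemma symplectic_linear_surj:
  assumes "linear L" and L: "\<And>v w. symplectic_form (L v) (L w) = symplectic_form v w"
  shows "surj L"
proof -
  have "inj L"
  proof (rule injI)
    fix v v' assume "L v = L v'"
    then show "v = v'"
      using L[of v] L[of v'] by (intro symplectic_form_nondegenerate) metis
  qed
  then show ?thesis using assms(1) by (simp add: linear_injective_imp_surjective)
qed

text \<open>
  Let \<open>y = F x\<close> and let \<open>F'\<close> be the derivative of \<open>F\<close> at \<open>x\<close>. Since \<open>F'\<close> is surjective, the two
  tangent vectors at \<open>y\<close> can be compared by pairing them with vectors \<open>F' v\<close>. The pairing with the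
  transported vector is \<open>dt * dK\<^sub>1(v) + ds * dK\<^sub>2(v)\<close> at \<open>x\<close> because \<open>F'\<close> preserves the form; the
  pairing with the prescribed vector is the same because \<open>K\<^sub>i \<circ> F = K\<^sub>i\<close>. The form is complex
  bilinear, so \<open>F'\<close> is automatically compatible with the complex directions \<open>dt\<close> and \<open>ds\<close>.
\<close>

lemma symplectic_maps_flow_differential:
  assumes symp: "symplectic F" and x: "x \<in> dom F"
    and K1: "\<And>x y. F x = Some y \<Longrightarrow> K1 \<beta> y = K1 \<alpha> x"
    and K2: "\<And>x y. F x = Some y \<Longrightarrow> K2 \<beta> y = K2 \<alpha> x"
  obtains F' where "((\<lambda>x. the (F x)) has_derivative F') (at x)"
    and "\<And>\<tau>. F' (flow_differential \<alpha> x \<tau>) = flow_differential \<beta> (the (F x)) \<tau>"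
proof -
  let ?\<phi> = "\<lambda>x. the (F x)"
  obtain F' where F': "(?\<phi> has_derivative F') (at x)"
    and form: "\<And>v w. symplectic_form (F' v) (F' w) = symplectic_form v w"
    using symp x unfolding symplectic_def by blast
  have chain: "differential (H \<beta>) (?\<phi> x) (F' v) = differential (H \<alpha>) x v"
    if "\<And>\<gamma>. polynomial_fun (H \<gamma>)" and H: "\<And>x y. F x = Some y \<Longrightarrow> H \<beta> y = H \<alpha> x"
    for H :: "params \<Rightarrow> phase \<Rightarrow> complex" and v
  proof -
    have "((\<lambda>x. H \<beta> (?\<phi> x)) has_derivative (\<lambda>v. differential (H \<beta>) (?\<phi> x) (F' v))) (at x)"
      by (rule has_derivative_compose[OF F' polynomial_fun_has_derivative[OF that(1)]])
    moreover have "((\<lambda>x. H \<beta> (?\<phi> x)) has_derivative differential (H \<alpha>) x) (at x)"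
    proof (rule has_derivative_transform_within_open)
      show "(H \<alpha> has_derivative differential (H \<alpha>) x) (at x)"
        by (rule polynomial_fun_has_derivative[OF that(1)])
      show "open (dom F)" using symp by (simp add: symplectic_def)
      show "x \<in> dom F" by (rule x)
      show "\<And>z. z \<in> dom F \<Longrightarrow> H \<alpha> z = H \<beta> (?\<phi> z)" using H by force
    qed
    ultimately show ?thesis by (metis has_derivative_unique)
  qed
  have "F' (flow_differential \<alpha> x \<tau>) = flow_differential \<beta> (?\<phi> x) \<tau>" for \<tau>
  proof (rule symplectic_form_nondegenerate)
    fix w
    obtain dt ds where \<tau>: "\<tau> = (dt, ds)" by (cases \<tau>)
    obtain v where w: "w = F' v"
      using symplectic_linear_surj[OF has_derivative_linear[OF F'] form] by (metis surjD)
    show "symplectic_form (F' (flow_differential \<alpha> x \<tau>)) w =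
        symplectic_form (flow_differential \<beta> (?\<phi> x) \<tau>) w"
      unfolding w form unfolding \<tau> symplectic_form_flow_differential
      by (simp add: chain[of K1, OF polynomial_fun_K1 K1] chain[of K2, OF polynomial_fun_K2 K2])
  qed
  with F' show thesis by (rule that)
qed

lemma carries_solutionsI:
  assumes S: "\<And>x u. S (x, u, \<alpha>) = map_option (\<lambda>y. (y, u, \<beta>)) (F x)"
    and symp: "symplectic F"
    and K1: "\<And>x y. F x = Some y \<Longrightarrow> K1 \<beta> y = K1 \<alpha> x"
    and K2: "\<And>x y. F x = Some y \<Longrightarrow> K2 \<beta> y = K2 \<alpha> x"
  shows "carries_solutions S \<alpha> \<beta>"
  unfolding carries_solutions_def
proof (intro allI impI, elim conjE)
  fix U q\<^sub>1 p\<^sub>1 q\<^sub>2 p\<^sub>2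
  assume sol: "is_solution \<alpha> U q\<^sub>1 p\<^sub>1 q\<^sub>2 p\<^sub>2"
    and dom: "\<forall>u\<in>U. ((q\<^sub>1 u, p\<^sub>1 u, q\<^sub>2 u, p\<^sub>2 u), u, \<alpha>) \<in> dom S"
  define X where "X u = (q\<^sub>1 u, p\<^sub>1 u, q\<^sub>2 u, p\<^sub>2 u)" for u
  define Y where "Y u = the (F (X u))" for u
  have X: "X u \<in> dom F" if "u \<in> U" for u
    using dom that by (auto simp: X_def S dom_def)
  have "(Y has_derivative flow_differential \<beta> (Y u)) (at u)" if u: "u \<in> U" for u
  proof -
    obtain F' where F': "((\<lambda>x. the (F x)) has_derivative F') (at (X u))"
      and flow: "\<And>\<tau>. F' (flow_differential \<alpha> (X u) \<tau>) = flow_differential \<beta> (the (F (X u))) \<tau>"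
      using symplectic_maps_flow_differential[OF symp X[OF u], of \<beta> \<alpha>] K1 K2 by metis
    have "(X has_derivative flow_differential \<alpha> (X u)) (at u)"
      using sol that unfolding is_solution_iff X_def by blast
    from has_derivative_compose[OF this F'] show ?thesis
      by (simp add: flow Y_def[abs_def])
  qed
  moreover have "Y = (\<lambda>u. (fst (Y u), fst (snd (Y u)), fst (snd (snd (Y u))), snd (snd (snd (Y u)))))"
    by simp
  moreover have "open U" using sol by (simp add: is_solution_iff)
  ultimately have "is_solution \<beta> U (\<lambda>u. fst (Y u)) (\<lambda>u. fst (snd (Y u)))
      (\<lambda>u. fst (snd (snd (Y u)))) (\<lambda>u. snd (snd (snd (Y u))))"
    unfolding is_solution_iff by simp
  moreover have "S ((q\<^sub>1 u, p\<^sub>1 u, q\<^sub>2 u, p\<^sub>2 u), u, \<alpha>) = Some (Y u, u, \<beta>)" if "u \<in> U" for u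
    using X[OF that] by (auto simp: X_def Y_def S)
  ultimately show "\<exists>Q\<^sub>1 P\<^sub>1 Q\<^sub>2 P\<^sub>2. is_solution \<beta> U Q\<^sub>1 P\<^sub>1 Q\<^sub>2 P\<^sub>2 \<and>
      (\<forall>u\<in>U. S ((q\<^sub>1 u, p\<^sub>1 u, q\<^sub>2 u, p\<^sub>2 u), u, \<alpha>) = Some ((Q\<^sub>1 u, P\<^sub>1 u, Q\<^sub>2 u, P\<^sub>2 u), u, \<beta>))"
    by (intro exI conjI) auto
qed

text \<open>
  Partial maps are written below as total formulas restricted to the set where the denominators
  do not vanish; on this open set the derivative is that of the formula.
\<close>

lemma symplectic_restrict_mapI:
  assumes "open D"
    and "\<And>x. x \<in> D \<Longrightarrow> (\<phi> has_derivative \<phi>' x) (at x)"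
    and "\<And>x v w. x \<in> D \<Longrightarrow> symplectic_form (\<phi>' x v) (\<phi>' x w) = symplectic_form v w"
  shows "symplectic ((\<lambda>x. Some (\<phi> x)) |` D)"
  unfolding symplectic_def
proof (intro conjI ballI)
  let ?F = "(\<lambda>x. Some (\<phi> x)) |` D"
  have dom: "dom ?F = D" by (simp add: restrict_map_def dom_def del: split_paired_Ex)
  show "open (dom ?F)" by (simp only: dom assms(1))
  fix x assume "x \<in> dom ?F"
  then have x: "x \<in> D" by (simp only: dom)
  have "((\<lambda>x. the (?F x)) has_derivative \<phi>' x) (at x)"
    by (rule has_derivative_transform_within_open[OF assms(2)[OF x] assms(1) x]) simp
  then show "\<exists>F'. ((\<lambda>x. the (?F x)) has_derivative F') (at x) \<and>
      (\<forall>v w. symplectic_form (F' v) (F' w) = symplectic_form v w)"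
    using assms(3)[OF x] by blast
qed

text \<open>
  The candidate \<open>\<psi>\<close> for the inverse is restricted to the same set as \<open>\<phi>\<close>. Both composites are then
  defined on all of \<open>D\<close>.
\<close>

lemma invariant_birational_symplecticI:
  fixes D :: "phase set"
  assumes "\<beta> \<in> param_space"
    and S: "\<And>x u. S (x, u, \<alpha>) = (if x \<in> D then Some (\<phi> x, u, \<beta>) else None)"
    and symp: "symplectic ((\<lambda>x. Some (\<phi> x)) |` D)"
    and K1: "\<And>x. x \<in> D \<Longrightarrow> K1 \<beta> (\<phi> x) = K1 \<alpha> x"
    and K2: "\<And>x. x \<in> D \<Longrightarrow> K2 \<beta> (\<phi> x) = K2 \<alpha> x"
    and rat: "rational_map ((\<lambda>x. Some (\<phi> x)) |` D)" "rational_map ((\<lambda>x. Some (\<psi> x)) |` D)"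
    and ne: "D \<noteq> {}"
    and \<phi>: "\<And>x. x \<in> D \<Longrightarrow> \<phi> x \<in> D \<and> \<psi> (\<phi> x) = x"
    and \<psi>: "\<And>x. x \<in> D \<Longrightarrow> \<psi> x \<in> D \<and> \<phi> (\<psi> x) = x"
  shows "invariant_birational_symplectic S \<alpha> \<beta>"
proof -
  let ?F = "(\<lambda>x. Some (\<phi> x)) |` D" and ?G = "(\<lambda>x. Some (\<psi> x)) |` D"
  have "phase_map S u \<alpha> = ?F" for u
    by (simp add: phase_map_def S fun_eq_iff restrict_map_def)
  moreover have "birational ?F"
  proof -
    have "dom ?F \<noteq> {}" "dom ?G \<noteq> {}" using ne by (simp_all add: dom_restrict)
    moreover have "?G y = Some x" if "?F x = Some y" for x y
      using that \<phi>[of x] by (auto simp: restrict_map_def split: if_splits)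
    moreover have "?F y = Some x" if "?G x = Some y" for x y
      using that \<psi>[of x] by (auto simp: restrict_map_def split: if_splits)
    ultimately show ?thesis
      unfolding birational_def using rat by (blast intro: rational_left_inverseI)
  qed
  moreover have "carries_solutions S \<alpha> \<beta>"
  proof (rule carries_solutionsI[OF _ symp])
    show "S (x, u, \<alpha>) = map_option (\<lambda>y. (y, u, \<beta>)) (?F x)" for x u
      by (simp add: S restrict_map_def)
    have graph: "x \<in> D \<and> y = \<phi> x" if "?F x = Some y" for x y
      using that by (simp add: restrict_map_def split: if_splits)
    show "K1 \<beta> y = K1 \<alpha> x" "K2 \<beta> y = K2 \<alpha> x" if "?F x = Some y" for x y
      using graph[OF that] K1 K2 by simp_all
  qed
  ultimately show ?thesis
    unfolding invariant_birational_symplectic_def using assms(1) symp by simp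
qed

section \<open>The shifts \<open>s\<^sub>1\<close> and \<open>s\<^sub>2\<close>\<close>

lemma s1_invariant:
  assumes "2 * \<alpha>\<^sub>1 + 2 * \<alpha>\<^sub>2 + \<alpha>\<^sub>3 = 0"
  shows "invariant_birational_symplectic s1
       (\<alpha>\<^sub>1, \<alpha>\<^sub>2, \<alpha>\<^sub>3) (\<alpha>\<^sub>1 + 2 * \<alpha>\<^sub>2, - \<alpha>\<^sub>2, \<alpha>\<^sub>3)"
proof -
  define D :: "phase set" where "D = {x. fst (snd x) \<noteq> 0}"
  define \<phi> :: "complex \<Rightarrow> phase \<Rightarrow> phase" where
    "\<phi> a = (\<lambda>(q\<^sub>1, p\<^sub>1, q\<^sub>2, p\<^sub>2). (q\<^sub>1 + a / p\<^sub>1, p\<^sub>1, q\<^sub>2, p\<^sub>2))" for a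
  have rat: "rational_map ((\<lambda>x. Some (\<phi> a x)) |` D)" for a
    by (rule rational_map_common_denominator[where
          N\<^sub>1 = "\<lambda>(q\<^sub>1, p\<^sub>1, q\<^sub>2, p\<^sub>2). q\<^sub>1 * p\<^sub>1 + a" and N\<^sub>2 = "\<lambda>(q\<^sub>1, p\<^sub>1, q\<^sub>2, p\<^sub>2). p\<^sub>1 * p\<^sub>1"
          and N\<^sub>3 = "\<lambda>(q\<^sub>1, p\<^sub>1, q\<^sub>2, p\<^sub>2). q\<^sub>2 * p\<^sub>1" and N\<^sub>4 = "\<lambda>(q\<^sub>1, p\<^sub>1, q\<^sub>2, p\<^sub>2). p\<^sub>2 * p\<^sub>1"
          and D = "\<lambda>(q\<^sub>1, p\<^sub>1, q\<^sub>2, p\<^sub>2). p\<^sub>1" and x\<^sub>0 = "(0, 1, 0, 0)"]; (intro polynomial_fun_intros)?)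
       (auto simp: restrict_map_def D_def \<phi>_def field_simps)
  have inv: "\<phi> a x \<in> D \<and> \<phi> (- a) (\<phi> a x) = x" if "x \<in> D" for a x
    using that by (cases x) (simp add: D_def \<phi>_def)
  define \<phi>' :: "phase \<Rightarrow> phase \<Rightarrow> phase" where
    "\<phi>' x = (\<lambda>(a\<^sub>1, b\<^sub>1, a\<^sub>2, b\<^sub>2). (a\<^sub>1 - \<alpha>\<^sub>2 * b\<^sub>1 / (fst (snd x))\<^sup>2, b\<^sub>1, a\<^sub>2, b\<^sub>2))" for x
  have "symplectic ((\<lambda>x. Some (\<phi> \<alpha>\<^sub>2 x)) |` D)"
  proof (rule symplectic_restrict_mapI)
    show "open D"
      unfolding D_def by (intro open_Collect_neq continuous_intros)
    show "(\<phi> \<alpha>\<^sub>2 has_derivative \<phi>' x) (at x)" if "x \<in> D" for x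
      using that unfolding D_def \<phi>_def \<phi>'_def case_prod_unfold
      by (auto intro!: derivative_eq_intros simp: fun_eq_iff power2_eq_square)
    show "symplectic_form (\<phi>' x v) (\<phi>' x w) = symplectic_form v w" for x v w
      by (cases v; cases w) (simp add: \<phi>'_def algebra_simps)
  qed
  then show ?thesis
  proof (rule invariant_birational_symplecticI[rotated 2])
    show "(\<alpha>\<^sub>1 + 2 * \<alpha>\<^sub>2, - \<alpha>\<^sub>2, \<alpha>\<^sub>3) \<in> param_space"
      using assms by (simp add: param_space_def algebra_simps)
    show "s1 (x, u, \<alpha>\<^sub>1, \<alpha>\<^sub>2, \<alpha>\<^sub>3) =
        (if x \<in> D then Some (\<phi> \<alpha>\<^sub>2 x, u, \<alpha>\<^sub>1 + 2 * \<alpha>\<^sub>2, - \<alpha>\<^sub>2, \<alpha>\<^sub>3) else None)" for x u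
      by (cases x; cases u) (simp add: D_def \<phi>_def)
    show "K1 (\<alpha>\<^sub>1 + 2 * \<alpha>\<^sub>2, - \<alpha>\<^sub>2, \<alpha>\<^sub>3) (\<phi> \<alpha>\<^sub>2 x) = K1 (\<alpha>\<^sub>1, \<alpha>\<^sub>2, \<alpha>\<^sub>3) x" if "x \<in> D" for x
      using that by (cases x) (simp add: D_def \<phi>_def field_simps power2_eq_square)
    show "K2 (\<alpha>\<^sub>1 + 2 * \<alpha>\<^sub>2, - \<alpha>\<^sub>2, \<alpha>\<^sub>3) (\<phi> \<alpha>\<^sub>2 x) = K2 (\<alpha>\<^sub>1, \<alpha>\<^sub>2, \<alpha>\<^sub>3) x" if "x \<in> D" for x
      using that by (cases x) (simp add: D_def \<phi>_def field_simps power2_eq_square)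
    show "D \<noteq> {}" by (force simp: D_def)
    show "rational_map ((\<lambda>x. Some (\<phi> \<alpha>\<^sub>2 x)) |` D)" "rational_map ((\<lambda>x. Some (\<phi> (- \<alpha>\<^sub>2) x)) |` D)"
      by (rule rat)+
    show "\<phi> \<alpha>\<^sub>2 x \<in> D \<and> \<phi> (- \<alpha>\<^sub>2) (\<phi> \<alpha>\<^sub>2 x) = x" if "x \<in> D" for x
      using inv[OF that] .
    show "\<phi> (- \<alpha>\<^sub>2) x \<in> D \<and> \<phi> \<alpha>\<^sub>2 (\<phi> (- \<alpha>\<^sub>2) x) = x" if "x \<in> D" for x
      using inv[OF that, of "- \<alpha>\<^sub>2"] by simp
  qed
qed

lemma s2_invariant:
  assumes "2 * \<alpha>\<^sub>1 + 2 * \<alpha>\<^sub>2 + \<alpha>\<^sub>3 = 0"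
  shows "invariant_birational_symplectic s2
       (\<alpha>\<^sub>1, \<alpha>\<^sub>2, \<alpha>\<^sub>3) (\<alpha>\<^sub>1 + \<alpha>\<^sub>3, \<alpha>\<^sub>2, - \<alpha>\<^sub>3)"
proof -
  define D :: "phase set" where "D = {x. snd (snd (snd x)) \<noteq> 0}"
  define \<phi> :: "complex \<Rightarrow> phase \<Rightarrow> phase" where
    "\<phi> a = (\<lambda>(q\<^sub>1, p\<^sub>1, q\<^sub>2, p\<^sub>2). (q\<^sub>1, p\<^sub>1, q\<^sub>2 + a / p\<^sub>2, p\<^sub>2))" for a
  have rat: "rational_map ((\<lambda>x. Some (\<phi> a x)) |` D)" for a
    by (rule rational_map_common_denominator[where
          N\<^sub>1 = "\<lambda>(q\<^sub>1, p\<^sub>1, q\<^sub>2, p\<^sub>2). q\<^sub>1 * p\<^sub>2" and N\<^sub>2 = "\<lambda>(q\<^sub>1, p\<^sub>1, q\<^sub>2, p\<^sub>2). p\<^sub>1 * p\<^sub>2"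
          and N\<^sub>3 = "\<lambda>(q\<^sub>1, p\<^sub>1, q\<^sub>2, p\<^sub>2). q\<^sub>2 * p\<^sub>2 + a" and N\<^sub>4 = "\<lambda>(q\<^sub>1, p\<^sub>1, q\<^sub>2, p\<^sub>2). p\<^sub>2 * p\<^sub>2"
          and D = "\<lambda>(q\<^sub>1, p\<^sub>1, q\<^sub>2, p\<^sub>2). p\<^sub>2" and x\<^sub>0 = "(0, 0, 0, 1)"]; (intro polynomial_fun_intros)?)
       (auto simp: restrict_map_def D_def \<phi>_def field_simps)
  have inv: "\<phi> a x \<in> D \<and> \<phi> (- a) (\<phi> a x) = x" if "x \<in> D" for a x
    using that by (cases x) (simp add: D_def \<phi>_def)
  define \<phi>' :: "phase \<Rightarrow> phase \<Rightarrow> phase" where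
    "\<phi>' x = (\<lambda>(a\<^sub>1, b\<^sub>1, a\<^sub>2, b\<^sub>2). (a\<^sub>1, b\<^sub>1, a\<^sub>2 - \<alpha>\<^sub>3 * b\<^sub>2 / (snd (snd (snd x)))\<^sup>2, b\<^sub>2))" for x
  have "symplectic ((\<lambda>x. Some (\<phi> \<alpha>\<^sub>3 x)) |` D)"
  proof (rule symplectic_restrict_mapI)
    show "open D"
      unfolding D_def by (intro open_Collect_neq continuous_intros)
    show "(\<phi> \<alpha>\<^sub>3 has_derivative \<phi>' x) (at x)" if "x \<in> D" for x
      using that unfolding D_def \<phi>_def \<phi>'_def case_prod_unfold
      by (auto intro!: derivative_eq_intros simp: fun_eq_iff power2_eq_square)
    show "symplectic_form (\<phi>' x v) (\<phi>' x w) = symplectic_form v w" for x v w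
      by (cases v; cases w) (simp add: \<phi>'_def algebra_simps)
  qed
  then show ?thesis
  proof (rule invariant_birational_symplecticI[rotated 2])
    show "(\<alpha>\<^sub>1 + \<alpha>\<^sub>3, \<alpha>\<^sub>2, - \<alpha>\<^sub>3) \<in> param_space"
      using assms by (simp add: param_space_def algebra_simps)
    show "s2 (x, u, \<alpha>\<^sub>1, \<alpha>\<^sub>2, \<alpha>\<^sub>3) =
        (if x \<in> D then Some (\<phi> \<alpha>\<^sub>3 x, u, \<alpha>\<^sub>1 + \<alpha>\<^sub>3, \<alpha>\<^sub>2, - \<alpha>\<^sub>3) else None)" for x u
      by (cases x; cases u) (simp add: D_def \<phi>_def)
    show "K1 (\<alpha>\<^sub>1 + \<alpha>\<^sub>3, \<alpha>\<^sub>2, - \<alpha>\<^sub>3) (\<phi> \<alpha>\<^sub>3 x) = K1 (\<alpha>\<^sub>1, \<alpha>\<^sub>2, \<alpha>\<^sub>3) x" if "x \<in> D" for x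
      using that by (cases x) (simp add: D_def \<phi>_def field_simps power2_eq_square)
    show "K2 (\<alpha>\<^sub>1 + \<alpha>\<^sub>3, \<alpha>\<^sub>2, - \<alpha>\<^sub>3) (\<phi> \<alpha>\<^sub>3 x) = K2 (\<alpha>\<^sub>1, \<alpha>\<^sub>2, \<alpha>\<^sub>3) x" if "x \<in> D" for x
    proof -
      obtain q\<^sub>1 p\<^sub>1 q\<^sub>2 p\<^sub>2 where x: "x = (q\<^sub>1, p\<^sub>1, q\<^sub>2, p\<^sub>2)" by (cases x)
      \<comment> \<open>In terms of the shift \<open>e\<close> of \<open>q\<^sub>2\<close>, both sides are polynomials and coincide.\<close>
      define e where "e = \<alpha>\<^sub>3 / p\<^sub>2"
      have "\<alpha>\<^sub>3 = e * p\<^sub>2" using that by (simp add: e_def x D_def)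
      then show ?thesis
        unfolding x \<phi>_def prod.case e_def[symmetric] K2.simps by algebra
    qed
    show "D \<noteq> {}" by (force simp: D_def)
    show "rational_map ((\<lambda>x. Some (\<phi> \<alpha>\<^sub>3 x)) |` D)" "rational_map ((\<lambda>x. Some (\<phi> (- \<alpha>\<^sub>3) x)) |` D)"
      by (rule rat)+
    show "\<phi> \<alpha>\<^sub>3 x \<in> D \<and> \<phi> (- \<alpha>\<^sub>3) (\<phi> \<alpha>\<^sub>3 x) = x" if "x \<in> D" for x
      using inv[OF that] .
    show "\<phi> (- \<alpha>\<^sub>3) x \<in> D \<and> \<phi> \<alpha>\<^sub>3 (\<phi> (- \<alpha>\<^sub>3) x) = x" if "x \<in> D" for x
      using inv[OF that, of "- \<alpha>\<^sub>3"] by simp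
  qed
qed

section \<open>The transformation \<open>s\<^sub>3\<close>\<close>

definition s3_domain :: "phase set" where
  "s3_domain = {(q\<^sub>1, p\<^sub>1, q\<^sub>2, p\<^sub>2). p\<^sub>1 - q\<^sub>1\<^sup>2 - p\<^sub>2 \<noteq> 0 \<and> q\<^sub>1 + q\<^sub>2 \<noteq> 0}"

text \<open>
  The formulas for \<open>s\<^sub>3\<close>, with \<open>\<alpha>\<^sub>2\<close> eliminated by the relation between the parameters and with
  \<open>P\<^sub>1\<close> and \<open>Q\<^sub>2\<close> arranged so that \<open>P\<^sub>1 - Q\<^sub>1\<^sup>2 - P\<^sub>2 = f\<close> and \<open>Q\<^sub>1 + Q\<^sub>2 = - f / g\<close> are visible.
\<close>

definition s3_map :: "complex \<Rightarrow> complex \<Rightarrow> phase \<Rightarrow> phase" where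
  "s3_map \<alpha>\<^sub>1 \<alpha>\<^sub>3 = (\<lambda>(q\<^sub>1, p\<^sub>1, q\<^sub>2, p\<^sub>2).
     let f = p\<^sub>1 - q\<^sub>1\<^sup>2 - p\<^sub>2;
         g = q\<^sub>1 + q\<^sub>2;
         Q\<^sub>1 = q\<^sub>1 - (g * p\<^sub>2 - \<alpha>\<^sub>1) / f;
         P\<^sub>2 = g * (g * p\<^sub>2 + \<alpha>\<^sub>3) / f
     in (Q\<^sub>1, f + Q\<^sub>1\<^sup>2 + P\<^sub>2, - f / g - Q\<^sub>1, P\<^sub>2))"

text \<open>
  The map fixes \<open>f\<close> and sends \<open>g\<close> to \<open>- f / g\<close>, hence its domain to itself. Under
  \<open>w = g * p\<^sub>2 \<mapsto> - w - \<alpha>\<^sub>3\<close> and \<open>\<alpha>\<^sub>1 \<mapsto> - \<alpha>\<^sub>1 - \<alpha>\<^sub>3\<close> the quantity \<open>w - \<alpha>\<^sub>1\<close> changes sign, so the second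
  application shifts \<open>q\<^sub>1\<close> back.
\<close>

lemma s3_map_inverse:
  assumes "x \<in> s3_domain"
  shows "s3_map \<alpha>\<^sub>1 \<alpha>\<^sub>3 x \<in> s3_domain"
    and "s3_map (- \<alpha>\<^sub>1 - \<alpha>\<^sub>3) \<alpha>\<^sub>3 (s3_map \<alpha>\<^sub>1 \<alpha>\<^sub>3 x) = x"
proof -
  obtain q\<^sub>1 p\<^sub>1 q\<^sub>2 p\<^sub>2 where x: "x = (q\<^sub>1, p\<^sub>1, q\<^sub>2, p\<^sub>2)" by (cases x)
  define f g where "f = p\<^sub>1 - q\<^sub>1\<^sup>2 - p\<^sub>2" and "g = q\<^sub>1 + q\<^sub>2"
  have nz: "f \<noteq> 0" "g \<noteq> 0" using assms by (auto simp: s3_domain_def x f_def g_def)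
  define Q\<^sub>1 P\<^sub>2 where "Q\<^sub>1 = q\<^sub>1 - (g * p\<^sub>2 - \<alpha>\<^sub>1) / f" and "P\<^sub>2 = g * (g * p\<^sub>2 + \<alpha>\<^sub>3) / f"
  have y: "s3_map \<alpha>\<^sub>1 \<alpha>\<^sub>3 x = (Q\<^sub>1, f + Q\<^sub>1\<^sup>2 + P\<^sub>2, - f / g - Q\<^sub>1, P\<^sub>2)"
    by (simp only: s3_map_def x prod.case Let_def f_def g_def Q\<^sub>1_def P\<^sub>2_def)
  show "s3_map \<alpha>\<^sub>1 \<alpha>\<^sub>3 x \<in> s3_domain"
    using nz by (simp add: y s3_domain_def)
  have Q: "Q\<^sub>1 - (- f / g * P\<^sub>2 - (- \<alpha>\<^sub>1 - \<alpha>\<^sub>3)) / f = q\<^sub>1"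
    using nz by (simp add: Q\<^sub>1_def P\<^sub>2_def field_simps)
  have P: "- f / g * (- f / g * P\<^sub>2 + \<alpha>\<^sub>3) / f = p\<^sub>2"
    using nz by (simp add: P\<^sub>2_def field_simps)
  have "s3_map (- \<alpha>\<^sub>1 - \<alpha>\<^sub>3) \<alpha>\<^sub>3 (Q\<^sub>1, f + Q\<^sub>1\<^sup>2 + P\<^sub>2, - f / g - Q\<^sub>1, P\<^sub>2) =
      (q\<^sub>1, f + q\<^sub>1\<^sup>2 + p\<^sub>2, - f / (- f / g) - q\<^sub>1, p\<^sub>2)"
    unfolding s3_map_def prod.case Let_def using Q P by simp
  also have "- f / (- f / g) - q\<^sub>1 = q\<^sub>2" using nz by (simp add: g_def)
  also have "f + q\<^sub>1\<^sup>2 + p\<^sub>2 = p\<^sub>1" by (simp add: f_def)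
  finally show "s3_map (- \<alpha>\<^sub>1 - \<alpha>\<^sub>3) \<alpha>\<^sub>3 (s3_map \<alpha>\<^sub>1 \<alpha>\<^sub>3 x) = x"
    unfolding y unfolding x .
qed

lemma s3_map_rational: "rational_map ((\<lambda>x. Some (s3_map \<alpha>\<^sub>1 \<alpha>\<^sub>3 x)) |` s3_domain)"
proof -
  \<comment> \<open>The common denominator is \<open>f\<^sup>2 * g\<close>, where \<open>f\<^sup>2\<close> comes from \<open>Q\<^sub>1\<^sup>2\<close> in \<open>P\<^sub>1\<close>.\<close>
  let ?f = "\<lambda>q\<^sub>1 p\<^sub>1 q\<^sub>2 p\<^sub>2 :: complex. p\<^sub>1 - q\<^sub>1\<^sup>2 - p\<^sub>2"
  let ?n = "\<lambda>q\<^sub>1 p\<^sub>1 q\<^sub>2 p\<^sub>2 :: complex. q\<^sub>1 * (p\<^sub>1 - q\<^sub>1\<^sup>2 - p\<^sub>2) - ((q\<^sub>1 + q\<^sub>2) * p\<^sub>2 - \<alpha>\<^sub>1)"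
  let ?D = "\<lambda>(q\<^sub>1, p\<^sub>1, q\<^sub>2, p\<^sub>2). (?f q\<^sub>1 p\<^sub>1 q\<^sub>2 p\<^sub>2)\<^sup>2 * (q\<^sub>1 + q\<^sub>2)"
  let ?N\<^sub>1 = "\<lambda>(q\<^sub>1, p\<^sub>1, q\<^sub>2, p\<^sub>2). ?n q\<^sub>1 p\<^sub>1 q\<^sub>2 p\<^sub>2 * ?f q\<^sub>1 p\<^sub>1 q\<^sub>2 p\<^sub>2 * (q\<^sub>1 + q\<^sub>2)"
  let ?N\<^sub>2 = "\<lambda>(q\<^sub>1, p\<^sub>1, q\<^sub>2, p\<^sub>2). ?f q\<^sub>1 p\<^sub>1 q\<^sub>2 p\<^sub>2 ^ 3 * (q\<^sub>1 + q\<^sub>2) + (?n q\<^sub>1 p\<^sub>1 q\<^sub>2 p\<^sub>2)\<^sup>2 * (q\<^sub>1 + q\<^sub>2)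
    + (q\<^sub>1 + q\<^sub>2)\<^sup>2 * ((q\<^sub>1 + q\<^sub>2) * p\<^sub>2 + \<alpha>\<^sub>3) * ?f q\<^sub>1 p\<^sub>1 q\<^sub>2 p\<^sub>2"
  let ?N\<^sub>3 = "\<lambda>(q\<^sub>1, p\<^sub>1, q\<^sub>2, p\<^sub>2). - (?f q\<^sub>1 p\<^sub>1 q\<^sub>2 p\<^sub>2 ^ 3)
    - ?n q\<^sub>1 p\<^sub>1 q\<^sub>2 p\<^sub>2 * ?f q\<^sub>1 p\<^sub>1 q\<^sub>2 p\<^sub>2 * (q\<^sub>1 + q\<^sub>2)"
  let ?N\<^sub>4 = "\<lambda>(q\<^sub>1, p\<^sub>1, q\<^sub>2, p\<^sub>2).
    (q\<^sub>1 + q\<^sub>2)\<^sup>2 * ((q\<^sub>1 + q\<^sub>2) * p\<^sub>2 + \<alpha>\<^sub>3) * ?f q\<^sub>1 p\<^sub>1 q\<^sub>2 p\<^sub>2"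
  have polys: "polynomial_fun ?N\<^sub>1" "polynomial_fun ?N\<^sub>2" "polynomial_fun ?N\<^sub>3"
    "polynomial_fun ?N\<^sub>4" "polynomial_fun ?D"
    by (intro polynomial_fun_intros)+
  have nonzero: "?D (1, 2, 0, 0) \<noteq> 0" by simp
  have eq: "((\<lambda>x. Some (s3_map \<alpha>\<^sub>1 \<alpha>\<^sub>3 x)) |` s3_domain) x =
    (if ?D x = 0 then None else Some (?N\<^sub>1 x / ?D x, ?N\<^sub>2 x / ?D x, ?N\<^sub>3 x / ?D x, ?N\<^sub>4 x / ?D x))" for x
  proof -
    obtain q\<^sub>1 p\<^sub>1 q\<^sub>2 p\<^sub>2 where x: "x = (q\<^sub>1, p\<^sub>1, q\<^sub>2, p\<^sub>2)" by (cases x)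
    define f g where "f = p\<^sub>1 - q\<^sub>1\<^sup>2 - p\<^sub>2" and "g = q\<^sub>1 + q\<^sub>2"
    show ?thesis
    proof (cases "f = 0 \<or> g = 0")
      case True
      then show ?thesis
        by (auto simp: x s3_domain_def restrict_map_def f_def g_def)
    next
      case False
      define Q\<^sub>1 P\<^sub>2 where "Q\<^sub>1 = q\<^sub>1 - (g * p\<^sub>2 - \<alpha>\<^sub>1) / f" and "P\<^sub>2 = g * (g * p\<^sub>2 + \<alpha>\<^sub>3) / f"
      define n m where "n = q\<^sub>1 * f - (g * p\<^sub>2 - \<alpha>\<^sub>1)" and "m = g * p\<^sub>2 + \<alpha>\<^sub>3"
      have "Q\<^sub>1 = n / f" "P\<^sub>2 = g * m / f"
        using False by (simp_all add: Q\<^sub>1_def P\<^sub>2_def n_def m_def field_simps)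
      then have quotients:
        "Q\<^sub>1 = n * f * g / (f\<^sup>2 * g)"
        "f + Q\<^sub>1\<^sup>2 + P\<^sub>2 = (f ^ 3 * g + n\<^sup>2 * g + g\<^sup>2 * m * f) / (f\<^sup>2 * g)"
        "- f / g - Q\<^sub>1 = (- (f ^ 3) - n * f * g) / (f\<^sup>2 * g)"
        "P\<^sub>2 = g\<^sup>2 * m * f / (f\<^sup>2 * g)"
        using False by (auto simp: field_simps power2_eq_square power3_eq_cube)
      moreover have "s3_map \<alpha>\<^sub>1 \<alpha>\<^sub>3 x = (Q\<^sub>1, f + Q\<^sub>1\<^sup>2 + P\<^sub>2, - f / g - Q\<^sub>1, P\<^sub>2)"
        by (simp only: s3_map_def x prod.case Let_def f_def g_def Q\<^sub>1_def P\<^sub>2_def)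
      moreover have "x \<in> s3_domain" "f\<^sup>2 * g \<noteq> 0"
        using False by (simp_all add: x s3_domain_def f_def g_def)
      ultimately show ?thesis
        unfolding restrict_map_def unfolding x prod.case
          f_def[symmetric] g_def[symmetric] n_def[symmetric] m_def[symmetric] by simp
    qed
  qed
  show ?thesis
    by (rule rational_map_common_denominator[OF polys nonzero eq])
qed

text \<open>
  Primed functions are the differentials of the unprimed ones. The calculation passes through the
  canonical coordinates: the form at the image is \<open>dQ\<^sub>1 \<and> df + dG \<and> dP\<^sub>2\<close> with
  \<open>G = - f / g\<close>, the form at the source is \<open>dq\<^sub>1 \<and> df + dg \<and> dp\<^sub>2\<close>, and these two are compared.
\<close>

lemma s3_map_symplectic: "symplectic ((\<lambda>x. Some (s3_map \<alpha>\<^sub>1 \<alpha>\<^sub>3 x)) |` s3_domain)"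
proof -
  define f g q p :: "phase \<Rightarrow> complex"
    where "f = (\<lambda>x. fst (snd x) - (fst x)\<^sup>2 - snd (snd (snd x)))"
      and "g = (\<lambda>x. fst x + fst (snd (snd x)))"
      and "q = fst" and "p = (\<lambda>x. snd (snd (snd x)))"
  define f' where "f' x v = fst (snd v) - 2 * q x * fst v - snd (snd (snd v))" for x v :: phase
  define Q P where "Q x = q x - (g x * p x - \<alpha>\<^sub>1) / f x"
    and "P x = g x * (g x * p x + \<alpha>\<^sub>3) / f x" for x
  define w' where "w' x v = g x * p v + g v * p x" for x v :: phase
  define Q' where "Q' x v = q v - (w' x v * f x - (g x * p x - \<alpha>\<^sub>1) * f' x v) / (f x * f x)" for x v :: phase
  define P' where "P' x v = ((g x * w' x v + g v * (g x * p x + \<alpha>\<^sub>3)) * f x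
    - g x * (g x * p x + \<alpha>\<^sub>3) * f' x v) / (f x * f x)" for x v :: phase
  define G' where "G' x v = (- f' x v * g x + f x * g v) / (g x * g x)" for x v :: phase
  define \<phi>' :: "phase \<Rightarrow> phase \<Rightarrow> phase" where
    "\<phi>' x v = (Q' x v, f' x v + 2 * Q x * Q' x v + P' x v, G' x v - Q' x v, P' x v)" for x v
  have D: "s3_domain = {x. f x \<noteq> 0 \<and> g x \<noteq> 0}"
    by (auto simp: s3_domain_def f_def g_def)
  have map: "s3_map \<alpha>\<^sub>1 \<alpha>\<^sub>3 = (\<lambda>x. (Q x, f x + (Q x)\<^sup>2 + P x, - f x / g x - Q x, P x))"
    by (simp only: s3_map_def case_prod_unfold Let_def f_def g_def q_def p_def Q_def P_def)
  show ?thesis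
  proof (rule symplectic_restrict_mapI)
    show "open s3_domain"
      unfolding D f_def g_def
      by (intro open_Collect_conj open_Collect_neq continuous_intros)
    fix x assume "x \<in> s3_domain"
    then have nz: "f x \<noteq> 0" "g x \<noteq> 0" by (simp_all add: D)
    have f: "(f has_derivative f' x) (at x)"
      unfolding f_def f'_def[abs_def] q_def by (auto intro!: derivative_eq_intros)
    have g: "(g has_derivative g) (at x)" and q: "(q has_derivative q) (at x)"
      and p: "(p has_derivative p) (at x)"
      unfolding g_def q_def p_def by (auto intro!: derivative_eq_intros)
    have w: "((\<lambda>x. g x * p x + c) has_derivative w' x) (at x)" for c
      unfolding w'_def
      using has_derivative_add[OF has_derivative_mult[OF g p] has_derivative_const[of c]] by simp
    show "(s3_map \<alpha>\<^sub>1 \<alpha>\<^sub>3 has_derivative \<phi>' x) (at x)"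
    proof -
      have Q: "(Q has_derivative Q' x) (at x)"
        unfolding Q_def Q'_def
        using has_derivative_diff[OF q has_derivative_divide'[OF w[of "- \<alpha>\<^sub>1"] f nz(1)]] by simp
      have P: "(P has_derivative P' x) (at x)"
        unfolding P_def P'_def
        by (rule has_derivative_divide'[OF has_derivative_mult[OF g w[of \<alpha>\<^sub>3]] f nz(1)])
      have G: "((\<lambda>x. - f x / g x) has_derivative G' x) (at x)"
        unfolding G'_def
        using has_derivative_divide'[OF has_derivative_minus[OF f] g nz(2)] by simp
      have Q2: "((\<lambda>x. (Q x)\<^sup>2) has_derivative (\<lambda>v. 2 * Q x * Q' x v)) (at x)"
        using has_derivative_power[OF Q, of 2] by (simp add: ac_simps)
      show ?thesis
        unfolding map \<phi>'_def by (intro derivative_intros f G P Q Q2)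
    qed
    show "symplectic_form (\<phi>' x v) (\<phi>' x w) = symplectic_form v w" for v w
    proof -
      have "symplectic_form (\<phi>' x v) (\<phi>' x w) =
        (Q' x v * f' x w - f' x v * Q' x w) + (G' x v * P' x w - P' x v * G' x w)"
        by (simp add: \<phi>'_def algebra_simps)
      also have "\<dots> = (q v * f' x w - f' x v * q w) + (g v * p w - p v * g w)"
      proof -
        \<comment> \<open>Naming the inverses turns this into an ideal membership problem.\<close>
        define e h where "e = inverse (g x)" and "h = inverse (f x)"
        have "g x * e = 1" "f x * h = 1" using nz by (simp_all add: e_def h_def)
        then show ?thesis
          unfolding Q'_def P'_def G'_def w'_def divide_inverse inverse_mult_distrib
            e_def[symmetric] h_def[symmetric]
          by algebra
      qed
      also have "\<dots> = symplectic_form v w"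
        by (cases v; cases w) (simp add: f'_def q_def p_def g_def algebra_simps)
      finally show ?thesis .
    qed
  qed
qed

text \<open>
  With \<open>G = - f / g\<close> and \<open>u = (g * p\<^sub>2 - \<alpha>\<^sub>1) / f\<close>, the phase point is a polynomial in \<open>q\<^sub>1, g, G, u\<close> and
  \<open>1 / g\<close>, and the transformation is the symmetry that exchanges \<open>g\<close> and \<open>G\<close>, negates \<open>u\<close>, sends
  \<open>q\<^sub>1\<close> to \<open>q\<^sub>1 - u\<close> and \<open>\<alpha>\<^sub>1\<close> to \<open>- \<alpha>\<^sub>1 - \<alpha>\<^sub>3\<close>. In particular \<open>p\<^sub>2 = \<alpha>\<^sub>1 / g - G * u\<close> becomes
  \<open>P\<^sub>2 = - (\<alpha>\<^sub>1 + \<alpha>\<^sub>3) / G + g * u\<close>. Once \<open>\<alpha>\<^sub>3\<close> is expressed by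
  \<open>\<alpha>\<^sub>1\<close> and \<open>\<alpha>\<^sub>2\<close>, invariance of the Hamiltonians is a polynomial identity modulo \<open>g * e = 1\<close> and \<open>G * h = 1\<close>.
\<close>

lemma s3_map_preserves_hamiltonians:
  assumes "2 * \<alpha>\<^sub>1 + 2 * \<alpha>\<^sub>2 + \<alpha>\<^sub>3 = 0" and "x \<in> s3_domain"
  defines "\<beta> \<equiv> (- \<alpha>\<^sub>1 - \<alpha>\<^sub>3, 2 * \<alpha>\<^sub>1 + \<alpha>\<^sub>2 + \<alpha>\<^sub>3, \<alpha>\<^sub>3)"
  shows "K1 \<beta> (s3_map \<alpha>\<^sub>1 \<alpha>\<^sub>3 x) = K1 (\<alpha>\<^sub>1, \<alpha>\<^sub>2, \<alpha>\<^sub>3) x"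
    and "K2 \<beta> (s3_map \<alpha>\<^sub>1 \<alpha>\<^sub>3 x) = K2 (\<alpha>\<^sub>1, \<alpha>\<^sub>2, \<alpha>\<^sub>3) x"
proof -
  obtain q\<^sub>1 p\<^sub>1 q\<^sub>2 p\<^sub>2 where x: "x = (q\<^sub>1, p\<^sub>1, q\<^sub>2, p\<^sub>2)" by (cases x)
  define f g where "f = p\<^sub>1 - q\<^sub>1\<^sup>2 - p\<^sub>2" and "g = q\<^sub>1 + q\<^sub>2"
  define G u e h where "G = - f / g" and "u = (g * p\<^sub>2 - \<alpha>\<^sub>1) / f"
    and "e = 1 / g" and "h = 1 / G"
  have nz: "f \<noteq> 0" "g \<noteq> 0" using assms(2) by (auto simp: s3_domain_def x f_def g_def)
  have inverses: "g * e = 1" "G * h = 1"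
    using nz by (simp_all add: G_def e_def h_def)
  have \<alpha>\<^sub>3: "\<alpha>\<^sub>3 = - 2 * \<alpha>\<^sub>1 - 2 * \<alpha>\<^sub>2" using assms(1) by algebra
  have p\<^sub>2: "p\<^sub>2 = \<alpha>\<^sub>1 * e - G * u"
    using nz by (simp add: G_def u_def e_def field_simps)
  have x': "x = (q\<^sub>1, - g * G + q\<^sub>1\<^sup>2 + (\<alpha>\<^sub>1 * e - G * u), g - q\<^sub>1, \<alpha>\<^sub>1 * e - G * u)"
  proof -
    have "- g * G = f" using nz by (simp add: G_def)
    then show ?thesis unfolding p\<^sub>2[symmetric] by (simp add: x f_def g_def)
  qed
  have y: "s3_map \<alpha>\<^sub>1 \<alpha>\<^sub>3 x =
    (q\<^sub>1 - u, - g * G + (q\<^sub>1 - u)\<^sup>2 + (g * u - (\<alpha>\<^sub>1 + \<alpha>\<^sub>3) * h), G - (q\<^sub>1 - u), g * u - (\<alpha>\<^sub>1 + \<alpha>\<^sub>3) * h)"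
  proof -
    have "g * (g * p\<^sub>2 + \<alpha>\<^sub>3) / f = g * u - (\<alpha>\<^sub>1 + \<alpha>\<^sub>3) * h"
      using nz by (simp add: G_def u_def h_def field_simps)
    then show ?thesis
      using nz unfolding x s3_map_def prod.case f_def[symmetric] g_def[symmetric]
      by (simp add: Let_def G_def u_def)
  qed
  show "K1 \<beta> (s3_map \<alpha>\<^sub>1 \<alpha>\<^sub>3 x) = K1 (\<alpha>\<^sub>1, \<alpha>\<^sub>2, \<alpha>\<^sub>3) x"
    using inverses unfolding y \<beta>_def by (subst x') (unfold K1.simps \<alpha>\<^sub>3, algebra)
  show "K2 \<beta> (s3_map \<alpha>\<^sub>1 \<alpha>\<^sub>3 x) = K2 (\<alpha>\<^sub>1, \<alpha>\<^sub>2, \<alpha>\<^sub>3) x"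
    using inverses unfolding y \<beta>_def by (subst x') (unfold K2.simps \<alpha>\<^sub>3, algebra)
qed

lemma s3_eq_s3_map:
  assumes "2 * \<alpha>\<^sub>1 + 2 * \<alpha>\<^sub>2 + \<alpha>\<^sub>3 = 0"
  shows "s3 (x, u, \<alpha>\<^sub>1, \<alpha>\<^sub>2, \<alpha>\<^sub>3) = (if x \<in> s3_domain
    then Some (s3_map \<alpha>\<^sub>1 \<alpha>\<^sub>3 x, u, - \<alpha>\<^sub>1 - \<alpha>\<^sub>3, 2 * \<alpha>\<^sub>1 + \<alpha>\<^sub>2 + \<alpha>\<^sub>3, \<alpha>\<^sub>3) else None)"
proof -
  obtain q\<^sub>1 p\<^sub>1 q\<^sub>2 p\<^sub>2 where x: "x = (q\<^sub>1, p\<^sub>1, q\<^sub>2, p\<^sub>2)" by (cases x)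
  obtain t s where u: "u = (t, s)" by (cases u)
  have \<alpha>\<^sub>3: "\<alpha>\<^sub>3 = - 2 * \<alpha>\<^sub>1 - 2 * \<alpha>\<^sub>2" using assms by algebra
  define f g where "f = p\<^sub>1 - q\<^sub>1\<^sup>2 - p\<^sub>2" and "g = q\<^sub>1 + q\<^sub>2"
  show ?thesis
  proof (cases "f = 0 \<or> g = 0")
    case True
    then show ?thesis by (auto simp: x u s3_domain_def f_def g_def Let_def)
  next
    case False
    have Q: "(q\<^sub>1 * f - g * p\<^sub>2 + \<alpha>\<^sub>1) / f = q\<^sub>1 - (g * p\<^sub>2 - \<alpha>\<^sub>1) / f"
      using False by (simp add: field_simps)
    have P: "- (g * (- g * p\<^sub>2 + 2 * \<alpha>\<^sub>1 + 2 * \<alpha>\<^sub>2) / f) = g * (g * p\<^sub>2 + \<alpha>\<^sub>3) / f"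
      using False by (simp add: \<alpha>\<^sub>3 field_simps)
    have "s3 (x, u, \<alpha>\<^sub>1, \<alpha>\<^sub>2, \<alpha>\<^sub>3) = Some (s3_map \<alpha>\<^sub>1 \<alpha>\<^sub>3 x, u, - \<alpha>\<^sub>1 - \<alpha>\<^sub>3, 2 * \<alpha>\<^sub>1 + \<alpha>\<^sub>2 + \<alpha>\<^sub>3, \<alpha>\<^sub>3)"
      using False unfolding x u s3.simps s3_map_def prod.case
        f_def[symmetric] g_def[symmetric] Let_def Q[symmetric] P[symmetric]
      by (simp add: power_divide)
    then show ?thesis using False by (simp add: x s3_domain_def f_def g_def)
  qed
qed

lemma s3_invariant:
  assumes "2 * \<alpha>\<^sub>1 + 2 * \<alpha>\<^sub>2 + \<alpha>\<^sub>3 = 0"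
  shows "invariant_birational_symplectic s3
       (\<alpha>\<^sub>1, \<alpha>\<^sub>2, \<alpha>\<^sub>3) (- \<alpha>\<^sub>1 - \<alpha>\<^sub>3, 2 * \<alpha>\<^sub>1 + \<alpha>\<^sub>2 + \<alpha>\<^sub>3, \<alpha>\<^sub>3)"
proof (rule invariant_birational_symplecticI
    [where D = s3_domain and \<phi> = "s3_map \<alpha>\<^sub>1 \<alpha>\<^sub>3" and \<psi> = "s3_map (- \<alpha>\<^sub>1 - \<alpha>\<^sub>3) \<alpha>\<^sub>3"])
  show "(- \<alpha>\<^sub>1 - \<alpha>\<^sub>3, 2 * \<alpha>\<^sub>1 + \<alpha>\<^sub>2 + \<alpha>\<^sub>3, \<alpha>\<^sub>3) \<in> param_space"
    using assms by (simp add: param_space_def algebra_simps)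
  have "(1, 2, 0, 0) \<in> s3_domain" by (simp add: s3_domain_def)
  then show "s3_domain \<noteq> {}" by blast
  show "s3_map (- \<alpha>\<^sub>1 - \<alpha>\<^sub>3) \<alpha>\<^sub>3 x \<in> s3_domain \<and>
      s3_map \<alpha>\<^sub>1 \<alpha>\<^sub>3 (s3_map (- \<alpha>\<^sub>1 - \<alpha>\<^sub>3) \<alpha>\<^sub>3 x) = x" if "x \<in> s3_domain" for x
    using s3_map_inverse[OF that, of "- \<alpha>\<^sub>1 - \<alpha>\<^sub>3" \<alpha>\<^sub>3] by simp
qed (simp_all only: s3_eq_s3_map[OF assms] s3_map_symplectic s3_map_rational s3_map_inverse
    s3_map_preserves_hamiltonians[OF assms] simp_thms)

theorem proposition5p4:
  fixes \<alpha>\<^sub>1 \<alpha>\<^sub>2 \<alpha>\<^sub>3 :: complex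
  assumes "2 * \<alpha>\<^sub>1 + 2 * \<alpha>\<^sub>2 + \<alpha>\<^sub>3 = 0"
  shows
    "invariant_birational_symplectic s1
       (\<alpha>\<^sub>1, \<alpha>\<^sub>2, \<alpha>\<^sub>3) (\<alpha>\<^sub>1 + 2 * \<alpha>\<^sub>2, - \<alpha>\<^sub>2, \<alpha>\<^sub>3) \<and>
     invariant_birational_symplectic s2
       (\<alpha>\<^sub>1, \<alpha>\<^sub>2, \<alpha>\<^sub>3) (\<alpha>\<^sub>1 + \<alpha>\<^sub>3, \<alpha>\<^sub>2, - \<alpha>\<^sub>3) \<and>
     invariant_birational_symplectic s3
       (\<alpha>\<^sub>1, \<alpha>\<^sub>2, \<alpha>\<^sub>3) (- \<alpha>\<^sub>1 - \<alpha>\<^sub>3, 2 * \<alpha>\<^sub>1 + \<alpha>\<^sub>2 + \<alpha>\<^sub>3, \<alpha>\<^sub>3)"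
  using s1_invariant[OF assms] s2_invariant[OF assms] s3_invariant[OF assms] by blast

end
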